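(* For every $D>0$ and $c>0$ there are a constant $\delta>0$ and a threshold $n_0=n_0(c,D)$ such that the following holds. Let $A$ be a set of $n$ points in the plane in convex position (the vertex set of a convex polygon) such that at least $cn^2$ pairs of points of $A$ determine at most $Dn$ distinct directions. If $|A|\ge n_0$, then at least $\delta n$ points of $A$ lie on a conic.
   Context: The direction determined by a pair of distinct points is the direction (slope) of the line through them; "at least $cn^2$ pairs determine at most $Dn$ directions" means there is a set of at least $cn^2$ pairs of distinct points of $A$ whose connecting lines have at most $Dn$ distinct directions in total. *)

theory Defs
  imports "HOL-Analysis.Analysis"
begin

definition convex_position :: "(real^2) set \<Rightarrow> bool" where
  "convex_position A \<longleftrightarrow> (\<forall>p\<in>A. p \<notin> convex hull (A - {p}))"

text \<open>In particular, a finite set in convex position is the vertex set of the convex polygon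
  that it spans.\<close>

lemma convex_position_iff_extreme_points:
  assumes "finite A"
  shows "convex_position A \<longleftrightarrow> {p. p extreme_point_of (convex hull A)} = A"
proof
  assume *: "convex_position A"
  have "p extreme_point_of (convex hull A)" if "p \<in> A" for p
  proof -
    have "p extreme_point_of (convex hull (insert p (A - {p})))"
      using * that assms by (intro extreme_point_of_convex_hull_insert) (auto simp: convex_position_def)
    with that show ?thesis
      by (simp add: insert_absorb)
  qed
  then show "{p. p extreme_point_of (convex hull A)} = A"
    using extreme_point_of_convex_hull by blast
next
  assume *: "{p. p extreme_point_of (convex hull A)} = A"
  show "convex_position A"
    unfolding convex_position_def
  proof (intro ballI notI)
    fix p assume p: "p \<in> A" "p \<in> convex hull (A - {p})"
    then have "convex hull A = convex hull (A - {p})"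
      using hull_redundant[of p convex "A - {p}"] by (simp add: insert_absorb)
    with * p show False
      using extreme_point_of_convex_hull[of p "A - {p}"] by auto
  qed
qed

text \<open>Pairs of points are unordered, i.e. two-element sets. The direction of the line through
  distinct points \<open>p\<close> and \<open>q\<close> is represented by the parallel line through the origin, so that
  two lines have the same direction iff they are parallel or equal (vertical lines included).\<close>

definition point_pairs :: "(real^2) set \<Rightarrow> (real^2) set set" where
  "point_pairs A = {{p, q} |p q. p \<in> A \<and> q \<in> A \<and> p \<noteq> q}"

definition direction :: "real^2 \<Rightarrow> real^2 \<Rightarrow> (real^2) set" where
  "direction p q = span {q - p}"

definition determined_directions :: "(real^2) set set \<Rightarrow> (real^2) set set" where
  "determined_directions P = {direction p q |p q. {p, q} \<in> P \<and> p \<noteq> q}"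

text \<open>A conic is a real ellipse, parabola or hyperbola: the determinant condition (which forces
  the quadratic part to be nonzero) excludes pairs of lines, double lines and single points, and
  nonemptiness excludes the imaginary ellipses.\<close>

definition is_conic :: "(real^2) set \<Rightarrow> bool" where
  "is_conic C \<longleftrightarrow> C \<noteq> {} \<and>
    (\<exists>a b c d e f :: real.
       det (vector [vector [a, b, d], vector [b, c, e], vector [d, e, f]] :: real^3^3) \<noteq> 0 \<and>
       C = {p. a * (p$1)\<^sup>2 + 2 * b * p$1 * p$2 + c * (p$2)\<^sup>2 + 2 * d * p$1 + 2 * e * p$2 + f = 0})"

end

theory Submission imports Defs begin

text \<open>
  Number the points of \<open>A\<close> in cyclic order, and consider pairs of parallel, equally oriented chords
  \<open>a b\<close>, \<open>a' b'\<close>. By Cauchy--Schwarz there are at least \<open>\<kappa> n\<^sup>3\<close> of them. For fixed \<open>(b, b')\<close>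
  the pairs \<open>(a, a')\<close> form an increasing chain in the \<open>n \<times> n\<close> grid, because the direction of the
  chord \<open>a b\<close> turns monotonically with \<open>a\<close>. A chain meets only \<open>O(n / B)\<close> of the \<open>B \<times> B\<close> blocks of
  the grid, so for a large constant \<open>B\<close> most points of a typical chain lie in blocks containing at
  least three of them. As only \<open>O(n\<^sup>2)\<close> triples lie in a common block, some triple
  \<open>(a\<^sub>1, a\<^sub>1'), (a\<^sub>2, a\<^sub>2'), (a\<^sub>3, a\<^sub>3')\<close> belongs to the chains of at least \<open>\<epsilon> n\<close> pairs
  \<open>(b, b')\<close>. The three parallelity conditions determine \<open>b'\<close> as an affine function of \<open>b\<close> and
  place \<open>b\<close> on a quadric, which is a nondegenerate conic since no three points of \<open>A\<close> are collinear.
  The quadratic equation can only be trivial if \<open>b \<mapsto> b'\<close> is a positive homothety or a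
  translation, and no three points together with their images under such a map are in convex
  position.
\<close>

subsection \<open>Convex position and homotheties\<close>

text \<open>The determinant with columns \<open>u\<close> and \<open>v\<close>: zero for parallel
  vectors, positive when \<open>v\<close> points to the left of \<open>u\<close>.\<close>

definition cr :: "real^2 \<Rightarrow> real^2 \<Rightarrow> real" where
  "cr u v = u$1 * v$2 - u$2 * v$1"

lemma vec2_eq_iff: "(u::real^2) = v \<longleftrightarrow> u$1 = v$1 \<and> u$2 = v$2"
  by (simp add: vec_eq_iff forall_2)

lemma cr_zero_iff_scaled:
  assumes "u \<noteq> 0"
  shows "cr u v = 0 \<longleftrightarrow> (\<exists>l. v = l *\<^sub>R u)"
proof
  assume c: "cr u v = 0"
  show "\<exists>l. v = l *\<^sub>R u"
  proof (cases "u$1 = 0")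
    case True
    then have "u$2 \<noteq> 0" using assms by (simp add: vec2_eq_iff)
    then show ?thesis using c True
      by (intro exI[of _ "v$2 / u$2"]) (auto simp: vec2_eq_iff cr_def)
  next
    case False
    then show ?thesis using c
      by (intro exI[of _ "v$1 / u$1"]) (auto simp: vec2_eq_iff cr_def field_simps)
  qed
qed (auto simp: cr_def)

lemma cr_basis_zero:
  assumes "cr u v \<noteq> 0" "cr u w = 0" "cr v w = 0"
  shows "w = 0"
proof -
  have "cr u v * w$1 = 0" "cr u v * w$2 = 0"
    using assms(2,3) unfolding cr_def by algebra+
  then show ?thesis using assms(1) by (simp add: vec2_eq_iff)
qed

text \<open>The points \<open>x\<close>, \<open>y\<close>, \<open>z\<close> may coincide, so
  segments are covered as well as triangles.\<close>

lemma convex_position_no_combination: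
  assumes "convex_position A" "p \<in> A" "x \<in> A" "y \<in> A" "z \<in> A" "p \<noteq> x" "p \<noteq> y" "p \<noteq> z"
    and "u \<ge> 0" "v \<ge> 0" "w \<ge> 0" "u + v + w = 1"
  shows "p \<noteq> u *\<^sub>R x + v *\<^sub>R y + w *\<^sub>R z"
proof
  assume "p = u *\<^sub>R x + v *\<^sub>R y + w *\<^sub>R z"
  then have "p \<in> convex hull {x, y, z}"
    using assms unfolding convex_hull_3 by blast
  moreover have "convex hull {x, y, z} \<subseteq> convex hull (A - {p})"
    using assms by (intro hull_mono) auto
  ultimately show False
    using assms(1,2) unfolding convex_position_def by blast
qed

lemma convex_position_no_between:
  assumes "convex_position A" "p \<in> A" "x \<in> A" "y \<in> A" "p \<noteq> x" "p \<noteq> y" "0 \<le> u" "u \<le> 1"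
  shows "p \<noteq> x + u *\<^sub>R (y - x)"
  using convex_position_no_combination[OF assms(1-4) assms(4) assms(5,6,6), of "1-u" u 0] assms(7,8)
  by (simp add: algebra_simps)

text \<open>Of three collinear points one lies between the other two; the position \<open>l\<close>
  of \<open>y\<close> on the line, with \<open>p\<close> at 0 and \<open>x\<close> at 1, tells which
  one.\<close>

lemma convex_position_no_three_collinear:
  assumes A: "convex_position A" and i: "p \<in> A" "x \<in> A" "y \<in> A" and d: "p \<noteq> x" "p \<noteq> y" "x \<noteq> y"
  shows "cr (x - p) (y - p) \<noteq> 0"
proof
  assume "cr (x - p) (y - p) = 0"
  then obtain l where l: "y - p = l *\<^sub>R (x - p)"
    using cr_zero_iff_scaled[of "x - p"] d by auto
  consider "l < 0" | "0 \<le> l" "l \<le> 1" | "l > 1" by linarith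
  then show False
  proof cases
    case 1
    have "y - x = (1 - l) *\<^sub>R (p - x)" using l by (simp add: algebra_simps)
    then have "p = x + (1 / (1 - l)) *\<^sub>R (y - x)" using 1 by simp
    then show False using convex_position_no_between[OF A i d(1,2), of "1 / (1 - l)"] 1 by auto
  next
    case 2
    have "y = p + l *\<^sub>R (x - p)" using l by (simp add: algebra_simps)
    then show False using convex_position_no_between[OF A i(3,1,2), of l] 2 d by auto
  next
    case 3
    then have "x = p + (1/l) *\<^sub>R (y - p)" unfolding l by simp
    then show False using convex_position_no_between[OF A i(2,1,3), of "1/l"] 3 d by auto
  qed
qed

text \<open>Cramer's rule in the basis \<open>q - p\<close>, \<open>r - p\<close>. The prescribed
  sum \<open>s\<close> is 1 for a point of the plane; the homothety argument takes
  \<open>s = 1 - l\<close>.\<close>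

lemma barycentric_coordinates:
  assumes D: "cr (q - p) (r - p) \<noteq> 0"
  obtains a b c where "a + b + c = s" "t = a *\<^sub>R p + b *\<^sub>R q + c *\<^sub>R r"
proof -
  define D where "D = cr (q - p) (r - p)"
  define w where "w = t - s *\<^sub>R p"
  define b where "b = cr w (r - p) / D"
  define c where "c = cr (q - p) w / D"
  have "cr w (r - p) *\<^sub>R (q - p) + cr (q - p) w *\<^sub>R (r - p) = D *\<^sub>R w"
    by (simp add: vec2_eq_iff D_def cr_def algebra_simps)
  then have "(1/D) *\<^sub>R (cr w (r - p) *\<^sub>R (q - p) + cr (q - p) w *\<^sub>R (r - p)) = w"
    using D by (simp add: D_def)
  then have "b *\<^sub>R (q - p) + c *\<^sub>R (r - p) = w"
    by (simp add: b_def c_def scaleR_right_distrib)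
  then have "t = (s - b - c) *\<^sub>R p + b *\<^sub>R q + c *\<^sub>R r"
    by (simp add: w_def algebra_simps)
  then show ?thesis using that[of "s - b - c" b c] by simp
qed


text \<open>The translation part \<open>t\<close>, written as \<open>a p1 + b p2 + c p3\<close> with coefficients of sum \<open>1 - l \<ge> 0\<close>,
  has at most two negative coefficients, and each sign pattern exhibits one of the six points as a
  convex combination of three others.\<close>

lemma no_contracted_triple_in_convex_position:
  assumes A: "convex_position A"
    and p: "p1 \<in> A" "p2 \<in> A" "p3 \<in> A" "p1 \<noteq> p2" "p1 \<noteq> p3" "p2 \<noteq> p3"
    and r: "r1 \<in> A" "r2 \<in> A" "r3 \<in> A" "r1 \<noteq> p1" "r2 \<noteq> p2" "r3 \<noteq> p3"
    and l: "0 < l" "l \<le> 1"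
    and h: "r1 = l *\<^sub>R p1 + t" "r2 = l *\<^sub>R p2 + t" "r3 = l *\<^sub>R p3 + t"
  shows False
proof -
  have "cr (p2 - p1) (p3 - p1) \<noteq> 0"
    using convex_position_no_three_collinear[OF A] p by auto
  then obtain a b c where s: "a + b + c = 1 - l" and t: "t = a *\<^sub>R p1 + b *\<^sub>R p2 + c *\<^sub>R p3"
    by (rule barycentric_coordinates)
  \<comment> \<open>If \<open>y\<close> is the image of \<open>x\<close>, then the image of
    \<open>y\<close> is \<open>y + l (y - x)\<close>, so \<open>y\<close> lies between
    \<open>x\<close> and that image.\<close>
  have image_not_vertex: "l *\<^sub>R x + t \<noteq> y"
    if "x \<in> A" "y \<in> A" "x \<noteq> y" "l *\<^sub>R y + t \<in> A" "l *\<^sub>R y + t \<noteq> y" for x y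
  proof
    assume e: "l *\<^sub>R x + t = y"
    have "(l *\<^sub>R y + t) - x = (1 + l) *\<^sub>R (y - x)" using e by (simp add: algebra_simps)
    then have y: "y = x + (1 / (1 + l)) *\<^sub>R ((l *\<^sub>R y + t) - x)" using l by simp
    have "x \<noteq> y" "0 \<le> 1 / (1 + l)" "1 / (1 + l) \<le> 1" using that l by auto
    then show False
      using convex_position_no_between[OF A that(2,1,4), of "1 / (1 + l)"] y that by metis
  qed
  \<comment> \<open>The image of \<open>x\<close> is a convex combination of \<open>x\<close> and
    the images of \<open>y\<close> and \<open>z\<close>, with weights \<open>l\<close>,
    \<open>b\<close>, \<open>c\<close> divided by \<open>1 - a\<close>.\<close>
  have one_negative: False
    if xyz: "x \<in> A" "y \<in> A" "z \<in> A" "x \<noteq> y" "x \<noteq> z"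
      and img: "l *\<^sub>R x + t \<in> A" "l *\<^sub>R y + t \<in> A" "l *\<^sub>R z + t \<in> A" "l *\<^sub>R x + t \<noteq> x"
      and k: "a < 0" "b \<ge> 0" "c \<ge> 0" "a + b + c = 1 - l" "t = a *\<^sub>R x + b *\<^sub>R y + c *\<^sub>R z"
    for x y z and a b c :: real
  proof -
    have "(1 - a) *\<^sub>R (l *\<^sub>R x + t) = l *\<^sub>R x + b *\<^sub>R (l *\<^sub>R y + t) + c *\<^sub>R (l *\<^sub>R z + t)"
    proof -
      have "l *\<^sub>R x + b *\<^sub>R (l *\<^sub>R y + t) + c *\<^sub>R (l *\<^sub>R z + t)
          = l *\<^sub>R x + l *\<^sub>R (b *\<^sub>R y + c *\<^sub>R z) + (b + c) *\<^sub>R t"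
        by (simp add: algebra_simps)
      also have "b *\<^sub>R y + c *\<^sub>R z = t - a *\<^sub>R x" using k by simp
      also have "b + c = 1 - l - a" using k by simp
      finally show ?thesis by (simp add: algebra_simps)
    qed
    then have "l *\<^sub>R x + t = (1 / (1 - a)) *\<^sub>R (l *\<^sub>R x + b *\<^sub>R (l *\<^sub>R y + t) + c *\<^sub>R (l *\<^sub>R z + t))"
      using k by (metis (no_types) diff_gt_0_iff_gt divide_self less_irrefl less_trans scaleR_one
          scaleR_scaleR times_divide_eq_left mult_1 zero_less_one)
    then have "l *\<^sub>R x + t = (l / (1 - a)) *\<^sub>R x + (b / (1 - a)) *\<^sub>R (l *\<^sub>R y + t)
        + (c / (1 - a)) *\<^sub>R (l *\<^sub>R z + t)"
      by (simp add: scaleR_right_distrib)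
    moreover have "l / (1 - a) + b / (1 - a) + c / (1 - a) = 1"
      using k by (simp flip: add_divide_distrib)
    moreover have "l / (1 - a) \<ge> 0" "b / (1 - a) \<ge> 0" "c / (1 - a) \<ge> 0" using k l by auto
    ultimately show False
      using convex_position_no_combination[OF A img(1) xyz(1) img(2,3)] xyz img l by simp
  qed
  \<comment> \<open>Here \<open>z\<close> itself is a convex combination of its own image,
    \<open>x\<close> and \<open>y\<close>, with weights \<open>1\<close>, \<open>-a\<close>,
    \<open>-b\<close> divided by \<open>1 - a - b\<close>.\<close>
  have two_negative: False
    if xyz: "x \<in> A" "y \<in> A" "z \<in> A" "x \<noteq> z" "y \<noteq> z"
      and img: "l *\<^sub>R z + t \<in> A" "l *\<^sub>R z + t \<noteq> z"
      and k: "a < 0" "b < 0" "a + b + c = 1 - l" "t = a *\<^sub>R x + b *\<^sub>R y + c *\<^sub>R z"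
    for x y z and a b c :: real
  proof -
    have "(1 - a - b) *\<^sub>R z = (l *\<^sub>R z + t) + (- a) *\<^sub>R x + (- b) *\<^sub>R y"
    proof -
      have c: "c = 1 - l - a - b" using k by simp
      show ?thesis unfolding k(4) c by (simp add: algebra_simps)
    qed
    then have "z = (1 / (1 - a - b)) *\<^sub>R ((l *\<^sub>R z + t) + (- a) *\<^sub>R x + (- b) *\<^sub>R y)"
      using k by (metis (no_types, lifting) diff_gt_0_iff_gt divide_self less_irrefl less_trans scaleR_one
          scaleR_scaleR times_divide_eq_left mult_1 zero_less_one)
    then have "z = (1 / (1 - a - b)) *\<^sub>R (l *\<^sub>R z + t) + (- a / (1 - a - b)) *\<^sub>R x
        + (- b / (1 - a - b)) *\<^sub>R y"
      by (simp add: scaleR_right_distrib scaleR_right_diff_distrib)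
    moreover have "1 / (1 - a - b) + - a / (1 - a - b) + - b / (1 - a - b) = 1"
      using k by (simp flip: add_divide_distrib diff_divide_distrib)
    moreover have "1 / (1 - a - b) \<ge> 0" "- a / (1 - a - b) \<ge> 0" "- b / (1 - a - b) \<ge> 0"
      using k by (auto intro!: divide_nonpos_nonneg)
    ultimately show False
      using convex_position_no_combination[OF A xyz(3) img(1) xyz(1,2)] xyz img by metis
  qed
  \<comment> \<open>The point \<open>r1\<close> falls into the triangle \<open>p1\<close>,
    \<open>p2\<close>, \<open>p3\<close>; \<open>image_not_vertex\<close> rules out that it is
    \<open>p2\<close> or \<open>p3\<close>.\<close>
  have none_negative: False if "a \<ge> 0" "b \<ge> 0" "c \<ge> 0"
  proof -
    have "r1 = (l + a) *\<^sub>R p1 + b *\<^sub>R p2 + c *\<^sub>R p3" using h t by (simp add: algebra_simps)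
    moreover have "r1 \<noteq> p2" "r1 \<noteq> p3" using image_not_vertex p r unfolding h by blast+
    ultimately show False
      using convex_position_no_combination[OF A r(1) p(1-3), of "l + a" b c] r that l s by simp
  qed
  have t': "t = b *\<^sub>R p2 + a *\<^sub>R p1 + c *\<^sub>R p3" "t = c *\<^sub>R p3 + a *\<^sub>R p1 + b *\<^sub>R p2"
    "t = a *\<^sub>R p1 + c *\<^sub>R p3 + b *\<^sub>R p2" "t = b *\<^sub>R p2 + c *\<^sub>R p3 + a *\<^sub>R p1"
    using t by (auto simp: algebra_simps)
  have s': "b + a + c = 1 - l" "c + a + b = 1 - l" "a + c + b = 1 - l" "b + c + a = 1 - l"
    using s by auto
  note r' = r[unfolded h]
  consider "a \<ge> 0" "b \<ge> 0" "c \<ge> 0" | "a < 0" "b \<ge> 0" "c \<ge> 0" | "b < 0" "a \<ge> 0" "c \<ge> 0"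
    | "c < 0" "a \<ge> 0" "b \<ge> 0" | "a < 0" "b < 0" | "a < 0" "c < 0" | "b < 0" "c < 0"
    by linarith
  then show False
  proof cases
    case 1 then show ?thesis by (rule none_negative)
  next
    case 2 then show ?thesis
      using one_negative[OF p(1,2,3,4,5) r'(1,2,3,4) _ _ _ s t] by blast
  next
    case 3 then show ?thesis
      using one_negative[OF p(2,1,3) p(4)[symmetric] p(6) r'(2,1,3,5) _ _ _ s'(1) t'(1)] by blast
  next
    case 4 then show ?thesis
      using one_negative[OF p(3,1,2) p(5,6)[symmetric] r'(3,1,2,6) _ _ _ s'(2) t'(2)] by blast
  next
    case 5 then show ?thesis
      using two_negative[OF p(1,2,3,5,6) r'(3,6) _ _ s t] by blast
  next
    case 6 then show ?thesis
      using two_negative[OF p(1,3,2,4) p(6)[symmetric] r'(2,5) _ _ s'(3) t'(3)] by blast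
  next
    case 7 then show ?thesis
      using two_negative[OF p(2,3,1) p(4,5)[symmetric] r'(1,4) _ _ s'(4) t'(4)] by blast
  qed
qed

text \<open>For \<open>l > 1\<close> the inverse map, of ratio \<open>1/l\<close>, sends
  \<open>r1\<close>, \<open>r2\<close>, \<open>r3\<close> back to \<open>p1\<close>,
  \<open>p2\<close>, \<open>p3\<close>, and the contracting case applies.\<close>

lemma no_homothetic_triple_in_convex_position:
  assumes A: "convex_position A"
    and p: "p1 \<in> A" "p2 \<in> A" "p3 \<in> A" "p1 \<noteq> p2" "p1 \<noteq> p3" "p2 \<noteq> p3"
    and r: "r1 \<in> A" "r2 \<in> A" "r3 \<in> A" "r1 \<noteq> p1" "r2 \<noteq> p2" "r3 \<noteq> p3"
    and l: "0 < l"
    and h: "r1 = l *\<^sub>R p1 + t" "r2 = l *\<^sub>R p2 + t" "r3 = l *\<^sub>R p3 + t"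
  shows False
proof (cases "l \<le> 1")
  case True
  then show False using no_contracted_triple_in_convex_position[OF A p r l _ h] by simp
next
  case False
  have d: "r1 \<noteq> r2" "r1 \<noteq> r3" "r2 \<noteq> r3" using h p l by auto
  have "p1 = (1/l) *\<^sub>R r1 + (- (1/l) *\<^sub>R t)" "p2 = (1/l) *\<^sub>R r2 + (- (1/l) *\<^sub>R t)"
    "p3 = (1/l) *\<^sub>R r3 + (- (1/l) *\<^sub>R t)"
    using l h by (simp_all add: algebra_simps)
  then show False
    using no_contracted_triple_in_convex_position[OF A r(1,2,3) d p(1,2,3) r(4,5,6)[symmetric],
        of "1/l"] l False by auto
qed

subsection \<open>Conics as zero sets\<close>

text \<open>Degenerate polynomials and zero are included; the factors 2 make the coefficients the
  entries of the symmetric matrix in \<open>is_conic\<close>.\<close>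

definition quadratic_function :: "(real^2 \<Rightarrow> real) \<Rightarrow> bool" where
  "quadratic_function q \<longleftrightarrow> (\<exists>a b c d e f. \<forall>p. q p =
    a * (p$1)\<^sup>2 + 2 * b * p$1 * p$2 + c * (p$2)\<^sup>2 + 2 * d * p$1 + 2 * e * p$2 + f)"

text \<open>Three zeros of \<open>q\<close> span the homogeneous coordinate space, and the Gram matrix of \<open>q\<close> in this
  basis has zero diagonal. Its determinant is therefore twice the product of the three off-diagonal
  entries, and a vanishing entry puts the remaining zeros on a pair of lines.\<close>

lemma is_conic_zero_set:
  assumes q: "quadratic_function q" and nz: "q p0 \<noteq> 0"
    and Z: "card Z \<ge> 5" "\<And>p. p \<in> Z \<Longrightarrow> q p = 0"
    and nc: "\<And>p x y. p \<in> Z \<Longrightarrow> x \<in> Z \<Longrightarrow> y \<in> Z \<Longrightarrow> p \<noteq> x \<Longrightarrow> p \<noteq> y \<Longrightarrow> x \<noteq> y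
      \<Longrightarrow> cr (x - p) (y - p) \<noteq> 0"
  shows "is_conic {p. q p = 0}"
proof -
  obtain a b c d e f where q: "\<And>p. q p =
      a * (p$1)\<^sup>2 + 2 * b * p$1 * p$2 + c * (p$2)\<^sup>2 + 2 * d * p$1 + 2 * e * p$2 + f"
    using q unfolding quadratic_function_def by blast
  define Q :: "real^3^3" where "Q = vector [vector [a, b, d], vector [b, c, e], vector [d, e, f]]"
  \<comment> \<open>\<open>B\<close> is the symmetric bilinear form of \<open>Q\<close> in the
    homogeneous coordinates \<open>h\<close>; on the diagonal it equals \<open>q\<close>.\<close>
  define B where "B x y = a * x$1 * y$1 + b * (x$1 * y$2 + x$2 * y$1) + c * x$2 * y$2
      + d * (x$1 + y$1) + e * (x$2 + y$2) + f" for x y :: "real^2"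
  define h :: "real^2 \<Rightarrow> real^3" where "h x = vector [x$1, x$2, 1]" for x
  obtain T where "T \<subseteq> Z" "card T = 5" "finite T" using Z(1) obtain_subset_with_card_n by blast
  then obtain xs where xs: "set xs = T" "distinct xs" "length xs = 5"
    using finite_distinct_list distinct_card by metis
  then obtain x1 x2 x3 x4 x5 where "xs = [x1, x2, x3, x4, x5]"
    by (auto simp: numeral_eq_Suc length_Suc_conv)
  with xs \<open>T \<subseteq> Z\<close> have x: "x1 \<in> Z" "x2 \<in> Z" "x3 \<in> Z" "x4 \<in> Z" "x5 \<in> Z" "distinct [x1, x2, x3, x4, x5]"
    by auto
  have Bq: "B p p = q p" for p by (simp add: B_def q power2_eq_square algebra_simps)
  have Bsym: "B x y = B y x" for x y by (simp add: B_def algebra_simps)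
  have bary: "q (\<alpha> *\<^sub>R x + \<beta> *\<^sub>R y + \<gamma> *\<^sub>R z) = 2 * (\<alpha> * \<beta> * B x y + \<alpha> * \<gamma> * B x z + \<beta> * \<gamma> * B y z)"
    if "q x = 0" "q y = 0" "q z = 0" "\<alpha> + \<beta> + \<gamma> = 1" for x y z \<alpha> \<beta> \<gamma>
  proof -
    have g: "\<gamma> = 1 - \<alpha> - \<beta>" using that by simp
    have "q (\<alpha> *\<^sub>R x + \<beta> *\<^sub>R y + \<gamma> *\<^sub>R z) = 2 * (\<alpha> * \<beta> * B x y + \<alpha> * \<gamma> * B x z + \<beta> * \<gamma> * B y z)
       + \<alpha>\<^sup>2 * q x + \<beta>\<^sup>2 * q y + \<gamma>\<^sup>2 * q z"
      unfolding g q B_def by (simp add: power2_eq_square algebra_simps)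
    then show ?thesis using that by simp
  qed
  \<comment> \<open>If \<open>B x y = 0\<close>, then \<open>q\<close> is
    \<open>2 * \<gamma> * (\<alpha> * B x z + \<beta> * B y z)\<close> in barycentric coordinates.
    Both \<open>s\<close> and \<open>t\<close> have \<open>\<gamma> \<noteq> 0\<close>, so the
    second factor vanishes at \<open>s\<close>, \<open>t\<close> and \<open>z\<close>. These are not
    collinear, hence that factor is identically zero, and so is \<open>q\<close>, against the choice
    of \<open>p0\<close>.\<close>
  have conj_pair: False
    if m: "x \<in> Z" "y \<in> Z" "z \<in> Z" "s \<in> Z" "t \<in> Z" "distinct [x, y, z, s, t]" and B0: "B x y = 0"
    for x y z s t
  proof -
    have D: "cr (y - x) (z - x) \<noteq> 0" using m by (intro nc) auto
    have lin: "\<alpha> * B x z + \<beta> * B y z = 0"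
      if "w \<in> Z" "w \<noteq> x" "w \<noteq> y" "\<alpha> + \<beta> + \<gamma> = 1" "w = \<alpha> *\<^sub>R x + \<beta> *\<^sub>R y + \<gamma> *\<^sub>R z" for w \<alpha> \<beta> \<gamma>
    proof -
      have a: "\<alpha> = 1 - \<beta> - \<gamma>" using that by simp
      have "cr (y - x) (w - x) = \<gamma> * cr (y - x) (z - x)"
        unfolding that(5) a cr_def by (simp add: algebra_simps)
      moreover have "cr (y - x) (w - x) \<noteq> 0" using m that by (intro nc) auto
      ultimately have "\<gamma> \<noteq> 0" by auto
      moreover have "2 * \<gamma> * (\<alpha> * B x z + \<beta> * B y z) = 0"
        using bary[of x y z \<alpha> \<beta> \<gamma>] Z(2) m that B0 by (simp add: algebra_simps)
      ultimately show ?thesis by simp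
    qed
    obtain \<alpha> \<beta> \<gamma> where s: "\<alpha> + \<beta> + \<gamma> = 1" "s = \<alpha> *\<^sub>R x + \<beta> *\<^sub>R y + \<gamma> *\<^sub>R z"
      using barycentric_coordinates[OF D] by metis
    obtain \<alpha>' \<beta>' \<gamma>' where t: "\<alpha>' + \<beta>' + \<gamma>' = 1" "t = \<alpha>' *\<^sub>R x + \<beta>' *\<^sub>R y + \<gamma>' *\<^sub>R z"
      using barycentric_coordinates[OF D] by metis
    have ls: "\<alpha> * B x z + \<beta> * B y z = 0" using m by (intro lin[OF _ _ _ s]) auto
    have lt: "\<alpha>' * B x z + \<beta>' * B y z = 0" using m by (intro lin[OF _ _ _ t]) auto
    have "cr (s - z) (t - z) \<noteq> 0" using m by (intro nc) auto
    moreover have "cr (s - z) (t - z) = (\<alpha> * \<beta>' - \<alpha>' * \<beta>) * cr (x - z) (y - z)"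
    proof -
      have g: "\<gamma> = 1 - \<alpha> - \<beta>" "\<gamma>' = 1 - \<alpha>' - \<beta>'" using s t by auto
      show ?thesis unfolding s(2) t(2) g cr_def by (simp add: algebra_simps)
    qed
    ultimately have "\<alpha> * \<beta>' - \<alpha>' * \<beta> \<noteq> 0" by auto
    moreover have "(\<alpha> * \<beta>' - \<alpha>' * \<beta>) * B x z = 0" "(\<alpha> * \<beta>' - \<alpha>' * \<beta>) * B y z = 0"
      using ls lt by algebra+
    ultimately have "B x z = 0" "B y z = 0" by auto
    moreover obtain \<xi> \<eta> \<zeta> where "\<xi> + \<eta> + \<zeta> = 1" "p0 = \<xi> *\<^sub>R x + \<eta> *\<^sub>R y + \<zeta> *\<^sub>R z"
      using barycentric_coordinates[OF D] by metis
    ultimately show False using bary[of x y z \<xi> \<eta> \<zeta>] Z(2) m B0 nz by simp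
  qed
  have "det Q \<noteq> 0"
  proof
    assume "det Q = 0"
    define H :: "real^3^3" where "H = vector [h x1, h x2, h x3]"
    define G :: "real^3^3" where "G = vector [vector [B x1 x1, B x1 x2, B x1 x3],
      vector [B x2 x1, B x2 x2, B x2 x3], vector [B x3 x1, B x3 x2, B x3 x3]]"
    have "G = H ** Q ** transpose H"
      by (simp add: vec_eq_iff forall_3 G_def H_def Q_def h_def B_def matrix_matrix_mult_def
          transpose_def sum_3 algebra_simps)
    then have "det G = 0" using \<open>det Q = 0\<close> by (simp add: det_mul)
    moreover have "det G = 2 * B x1 x2 * B x1 x3 * B x2 x3"
      using Bsym[of x2 x1] Bsym[of x3 x1] Bsym[of x3 x2] Bq Z(2) x
      by (simp add: G_def det_3)
    ultimately consider "B x1 x2 = 0" | "B x1 x3 = 0" | "B x2 x3 = 0" by auto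
    then show False
    proof cases
      case 1 then show ?thesis using conj_pair[of x1 x2 x3 x4 x5] x by auto
    next
      case 2 then show ?thesis using conj_pair[of x1 x3 x2 x4 x5] x by auto
    next
      case 3 then show ?thesis using conj_pair[of x2 x3 x1 x4 x5] x by auto
    qed
  qed
  moreover have "x1 \<in> {p. q p = 0}" using x Z by auto
  ultimately show ?thesis
    unfolding is_conic_def Q_def q by blast
qed

lemma quadratic_functionI:
  assumes "\<And>p. q p = a * (p$1)\<^sup>2 + 2 * b * p$1 * p$2 + c * (p$2)\<^sup>2 + 2 * d * p$1 + 2 * e * p$2 + f"
  shows "quadratic_function q"
  using assms unfolding quadratic_function_def by blast

lemma quadratic_function_diff:
  assumes "quadratic_function q" "quadratic_function r"
  shows "quadratic_function (\<lambda>p. q p - r p)"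
proof -
  from assms obtain a b c d e f a' b' c' d' e' f' where
    "\<forall>p. q p = a * (p$1)\<^sup>2 + 2 * b * p$1 * p$2 + c * (p$2)\<^sup>2 + 2 * d * p$1 + 2 * e * p$2 + f"
    "\<forall>p. r p = a' * (p$1)\<^sup>2 + 2 * b' * p$1 * p$2 + c' * (p$2)\<^sup>2 + 2 * d' * p$1 + 2 * e' * p$2 + f'"
    unfolding quadratic_function_def by metis
  then show ?thesis
    by (intro quadratic_functionI[of _ "a - a'" "b - b'" "c - c'" "d - d'" "e - e'" "f - f'"])
      (simp add: algebra_simps)
qed

lemma quadratic_function_cr_mult_cr:
  "quadratic_function (\<lambda>p. cr (u - p) v * cr (p - w) z)"
proof -
  let ?b = "v$2 * z$1 + v$1 * z$2"
  let ?d = "cr u v * z$2 + v$2 * cr w z"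
  let ?e = "- (cr u v * z$1 + v$1 * cr w z)"
  have *: "cr (u - p) v * cr (p - w) z = - (v$2 * z$2) * (p$1)\<^sup>2 + ?b * p$1 * p$2 + - (v$1 * z$1) * (p$2)\<^sup>2
      + ?d * p$1 + ?e * p$2 + - (cr u v * cr w z)" for p
    by (simp add: cr_def power2_eq_square algebra_simps)
  have halves: "2 * (x / 2) = x" for x :: real by simp
  show ?thesis
    by (rule quadratic_functionI[of _ "- (v$2 * z$2)" "?b / 2" "- (v$1 * z$1)" "?d / 2" "?e / 2"
          "- (cr u v * cr w z)"]) (simp only: * halves)
qed

subsection \<open>Parallel chords from three fixed points\<close>

text \<open>Subtracting the first of the three conditions from the other two makes \<open>z\<close> an affine function
  of \<open>y\<close>; inserting it into the first condition gives the quadric.\<close>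

lemma quadric_of_parallel_chords:
  fixes a1 a2 a3 b1 b2 b3 :: "real^2"
  assumes nc: "cr (a2 - a1) (a3 - a1) \<noteq> 0"
  obtains q where "quadratic_function q"
    "\<And>y z. cr (y - a1) (z - b1) = 0 \<Longrightarrow> cr (y - a2) (z - b2) = 0 \<Longrightarrow> cr (y - a3) (z - b3) = 0
      \<Longrightarrow> q y = 0"
    "(\<exists>p. q p \<noteq> 0) \<or> (\<exists>l. \<forall>y z. cr (y - a1) (z - b1) = 0 \<longrightarrow> cr (y - a2) (z - b2) = 0
      \<longrightarrow> cr (y - a3) (z - b3) = 0 \<longrightarrow> z = l *\<^sub>R y + (b1 - l *\<^sub>R a1))"
proof -
  define \<alpha> where "\<alpha> = a2 - a1"
  define \<beta> where "\<beta> = a3 - a1"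
  define \<alpha>' where "\<alpha>' = b2 - b1"
  define \<beta>' where "\<beta>' = b3 - b1"
  define q where "q p = cr (a2 - p) \<alpha>' * cr (p - a1) \<beta> - cr (a3 - p) \<beta>' * cr (p - a1) \<alpha>" for p
  have ab: "cr \<alpha> \<beta> \<noteq> 0" using nc by (simp add: \<alpha>_def \<beta>_def)
  have affine: "cr \<alpha> (z - b1) = cr (a2 - y) \<alpha>'" "cr \<beta> (z - b1) = cr (a3 - y) \<beta>'"
    if "cr (y - a1) (z - b1) = 0" "cr (y - a2) (z - b2) = 0" "cr (y - a3) (z - b3) = 0" for y z
    using that unfolding \<alpha>_def \<beta>_def \<alpha>'_def \<beta>'_def cr_def by (simp_all add: algebra_simps)
  have "q y = 0"
    if "cr (y - a1) (z - b1) = 0" "cr (y - a2) (z - b2) = 0" "cr (y - a3) (z - b3) = 0" for y z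
  proof -
    \<comment> \<open>The identity \<open>cr \<alpha> v * cr u \<beta> - cr \<beta> v * cr u
      \<alpha> = cr \<alpha> \<beta> * cr u v\<close> with \<open>u = y - a1\<close> and
      \<open>v = z - b1\<close>.\<close>
    have "q y = cr \<alpha> \<beta> * cr (y - a1) (z - b1)"
      unfolding q_def unfolding affine[OF that, symmetric] unfolding cr_def by (simp add: algebra_simps)
    then show ?thesis using that by simp
  qed
  moreover have "\<exists>l. \<forall>y z. cr (y - a1) (z - b1) = 0 \<longrightarrow> cr (y - a2) (z - b2) = 0
      \<longrightarrow> cr (y - a3) (z - b3) = 0 \<longrightarrow> z = l *\<^sub>R y + (b1 - l *\<^sub>R a1)"
    if q0: "\<forall>p. q p = 0"
  proof -
    \<comment> \<open>Vanishing at these three points forces \<open>b2 - b1\<close> and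
      \<open>b3 - b1\<close> to be the same multiple \<open>l\<close> of \<open>a2 - a1\<close> and
      \<open>a3 - a1\<close>; then the affine map from \<open>y\<close> to \<open>z\<close> has
      linear part \<open>l\<close>.\<close>
    have "q (a1 + 2 *\<^sub>R \<alpha>) = - 2 * cr \<alpha> \<alpha>' * cr \<alpha> \<beta>" "q (a1 + 2 *\<^sub>R \<beta>) = - 2 * cr \<beta> \<beta>' * cr \<alpha> \<beta>"
      "q (a1 + \<alpha> + \<beta>) = - cr \<alpha> \<beta> * (cr \<beta> \<alpha>' + cr \<alpha> \<beta>')"
      by (simp_all add: q_def cr_def \<alpha>_def \<beta>_def algebra_simps)
    then have z: "cr \<alpha> \<alpha>' = 0" "cr \<beta> \<beta>' = 0" "cr \<beta> \<alpha>' + cr \<alpha> \<beta>' = 0"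
      using q0 ab by simp_all
    have "\<alpha> \<noteq> 0" "\<beta> \<noteq> 0" using ab by (auto simp: cr_def)
    then obtain l m where lm: "\<alpha>' = l *\<^sub>R \<alpha>" "\<beta>' = m *\<^sub>R \<beta>"
      using z cr_zero_iff_scaled by metis
    have "cr \<beta> \<alpha>' + cr \<alpha> \<beta>' = (m - l) * cr \<alpha> \<beta>"
      unfolding lm cr_def by (simp add: algebra_simps)
    then have ml: "m = l" using z ab by simp
    have "z = l *\<^sub>R y + (b1 - l *\<^sub>R a1)"
      if "cr (y - a1) (z - b1) = 0" "cr (y - a2) (z - b2) = 0" "cr (y - a3) (z - b3) = 0" for y z
    proof -
      define w where "w = (z - b1) - l *\<^sub>R (y - a1)"
      have "cr \<alpha> w = cr \<alpha> (z - b1) - cr (a2 - y) \<alpha>'" "cr \<beta> w = cr \<beta> (z - b1) - cr (a3 - y) \<beta>'"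
        unfolding lm ml w_def cr_def \<alpha>_def \<beta>_def by (simp_all add: algebra_simps)
      then have "w = 0" using affine[OF that] cr_basis_zero[OF ab] by simp
      then show ?thesis by (simp add: w_def algebra_simps)
    qed
    then show ?thesis by blast
  qed
  moreover have "quadratic_function q"
    unfolding q_def by (intro quadratic_function_diff quadratic_function_cr_mult_cr)
  ultimately show ?thesis using that by blast
qed

text \<open>For a nonzero vector \<open>sgn\<close> is the unit vector along it, so equality of
  \<open>sgn\<close> encodes being parallel and equally oriented.\<close>

lemma sgn_eq_imp_scaled:
  fixes u v :: "'a::real_normed_vector"
  assumes "sgn u = sgn v" "u \<noteq> 0"
  obtains l where "l > 0" "v = l *\<^sub>R u"
proof
  have "v \<noteq> 0" using assms by (metis sgn_zero_iff)
  then show "norm v / norm u > 0" using assms(2) by simp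
  have "v = norm v *\<^sub>R sgn v" using \<open>v \<noteq> 0\<close> by (simp add: sgn_div_norm)
  then show "v = (norm v / norm u) *\<^sub>R u"
    using assms by (metis sgn_div_norm scaleR_scaleR divide_inverse)
qed

text \<open>Either the quadric is nontrivial and contains at least five points with no three
  collinear, hence is a conic, or \<open>z\<close> arises from \<open>y\<close> by a positive
  homothety or a translation, which convex position excludes.\<close>

lemma parallel_chords_on_conic:
  fixes Y :: "((real^2) \<times> (real^2)) set"
  assumes A: "convex_position A"
    and a: "a1 \<in> A" "a2 \<in> A" "a3 \<in> A" "a1 \<noteq> a2" "a1 \<noteq> a3" "a2 \<noteq> a3" and b1: "b1 \<in> A"
    and Y: "Y \<subseteq> A \<times> A" "card Y \<ge> 5"
    and ne: "\<And>y z. (y, z) \<in> Y \<Longrightarrow> y \<noteq> z \<and> y \<noteq> a1 \<and> y \<noteq> a2 \<and> y \<noteq> a3"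
    and sg: "\<And>y z. (y, z) \<in> Y \<Longrightarrow> sgn (y - a1) = sgn (z - b1) \<and> sgn (y - a2) = sgn (z - b2)
      \<and> sgn (y - a3) = sgn (z - b3)"
  shows "\<exists>C. is_conic C \<and> fst ` Y \<subseteq> C \<and> inj_on fst Y"
proof -
  have nc: "cr (x - p) (y - p) \<noteq> 0" if "p \<in> A" "x \<in> A" "y \<in> A" "p \<noteq> x" "p \<noteq> y" "x \<noteq> y" for p x y
    using convex_position_no_three_collinear[OF A that] .
  have cr0: "cr (y - u) (z - v) = 0" if "sgn (y - u) = sgn (z - v)" "y \<noteq> u" for y z u v
    using sgn_eq_imp_scaled[OF that(1)] that(2) cr_zero_iff_scaled[of "y - u"]
    by (metis right_minus_eq)
  have par: "cr (y - a1) (z - b1) = 0" "cr (y - a2) (z - b2) = 0" "cr (y - a3) (z - b3) = 0"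
    if "(y, z) \<in> Y" for y z
    using that sg ne cr0 by blast+
  \<comment> \<open>For given \<open>y\<close> all possible \<open>z\<close> lie on one ray from
    \<open>b1\<close>, which contains at most one further point of \<open>A\<close>.\<close>
  have inj: "inj_on fst Y"
  proof (rule inj_onI, clarsimp)
    fix y z z' assume y: "(y, z) \<in> Y" "(y, z') \<in> Y"
    show "z = z'"
    proof (rule ccontr)
      assume "z \<noteq> z'"
      have e: "sgn (z - b1) = sgn (z' - b1)" using sg y by metis
      have zb: "z \<noteq> b1" "z' \<noteq> b1" using sg y ne
        by (metis right_minus_eq sgn_zero_iff)+
      have "cr (z - b1) (z' - b1) \<noteq> 0"
        using \<open>z \<noteq> z'\<close> y Y zb b1 by (intro nc) auto
      then show False using cr0[OF e] zb by simp
    qed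
  qed
  have "cr (a2 - a1) (a3 - a1) \<noteq> 0" using a by (intro nc) auto
  then obtain q where q: "quadratic_function q" and qY: "\<And>y z. (y, z) \<in> Y \<Longrightarrow> q y = 0"
    and dich: "(\<exists>p. q p \<noteq> 0) \<or> (\<exists>l. \<forall>y z. (y, z) \<in> Y \<longrightarrow> z = l *\<^sub>R y + (b1 - l *\<^sub>R a1))"
    using quadric_of_parallel_chords[of a2 a1 a3 b1 b2 b3] par by metis
  have c: "card (fst ` Y) \<ge> 5" using Y inj by (simp add: card_image)
  have sub: "fst ` Y \<subseteq> A" using Y by auto
  from dich show ?thesis
  proof
    assume "\<exists>p. q p \<noteq> 0"
    then obtain p0 where p0: "q p0 \<noteq> 0" by blast
    have "is_conic {p. q p = 0}"
    proof (rule is_conic_zero_set[OF q p0 c])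
      show "q p = 0" if "p \<in> fst ` Y" for p
        using that qY by force
      show "cr (x - p) (y - p) \<noteq> 0"
        if "p \<in> fst ` Y" "x \<in> fst ` Y" "y \<in> fst ` Y" "p \<noteq> x" "p \<noteq> y" "x \<noteq> y" for p x y
        using nc that sub by (meson subsetD)
    qed
    then show ?thesis using qY inj by (intro exI[of _ "{p. q p = 0}"]) auto
  next
    assume "\<exists>l. \<forall>y z. (y, z) \<in> Y \<longrightarrow> z = l *\<^sub>R y + (b1 - l *\<^sub>R a1)"
    then obtain l where l: "\<And>y z. (y, z) \<in> Y \<Longrightarrow> z = l *\<^sub>R y + (b1 - l *\<^sub>R a1)" by blast
    obtain T where "T \<subseteq> fst ` Y" "card T = 3" using c obtain_subset_with_card_n[of 3 "fst ` Y"] by auto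
    then obtain y1 y2 y3 where T: "T = {y1, y2, y3}" "y1 \<noteq> y2" "y1 \<noteq> y3" "y2 \<noteq> y3"
      by (auto simp: card_3_iff)
    with \<open>T \<subseteq> fst ` Y\<close> obtain z1 z2 z3 where yz: "(y1, z1) \<in> Y" "(y2, z2) \<in> Y" "(y3, z3) \<in> Y"
      by auto
    \<comment> \<open>The factor \<open>l\<close> relates the equally oriented vectors
      \<open>y1 - a1\<close> and \<open>z1 - b1\<close>; parallelity alone would allow a negative
      factor.\<close>
    have "l > 0"
    proof -
      have "y1 - a1 \<noteq> 0" using ne yz by auto
      then obtain m where m: "m > 0" "z1 - b1 = m *\<^sub>R (y1 - a1)"
        using sgn_eq_imp_scaled[of "y1 - a1" "z1 - b1"] sg[OF yz(1)] by blast
      have "z1 - b1 = l *\<^sub>R (y1 - a1)" using l[OF yz(1)] by (simp add: algebra_simps)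
      then have "l = m" using m \<open>y1 - a1 \<noteq> 0\<close> by simp
      then show ?thesis using m by simp
    qed
    moreover have "y1 \<in> A" "y2 \<in> A" "y3 \<in> A" "z1 \<in> A" "z2 \<in> A" "z3 \<in> A" using yz Y by auto
    moreover have "z1 \<noteq> y1" "z2 \<noteq> y2" "z3 \<noteq> y3" using yz ne by blast+
    ultimately have False
      using no_homothetic_triple_in_convex_position[OF A] T(2-4) l[OF yz(1)] l[OF yz(2)] l[OF yz(3)]
      by blast
    then show ?thesis ..
  qed
qed

subsection \<open>The cyclic order of points in convex position\<close>

text \<open>The points are sorted by angle around a point \<open>o0\<close> of \<open>A\<close>,
  which comes first, and \<open>idx\<close> counts predecessors. The other points are seen from
  \<open>o0\<close> within an open half-plane, so the angular order is linear.\<close>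

lemma convex_position_cyclic_index:
  assumes fin: "finite A" and A: "convex_position A"
  obtains idx :: "real^2 \<Rightarrow> nat" where "inj_on idx A" "idx ` A \<subseteq> {..<card A}"
    "\<And>a b c. a \<in> A \<Longrightarrow> b \<in> A \<Longrightarrow> c \<in> A \<Longrightarrow> idx a < idx b \<Longrightarrow> idx b < idx c \<Longrightarrow> cr (b - a) (c - a) > 0"
proof (cases "A = {}")
  case True
  then show ?thesis using that by simp
next
  case False
  then obtain o0 where o: "o0 \<in> A" by blast
  have nc: "cr (x - p) (y - p) \<noteq> 0" if "p \<in> A" "x \<in> A" "y \<in> A" "p \<noteq> x" "p \<noteq> y" "x \<noteq> y" for p x y
    using convex_position_no_three_collinear[OF A that] .
  have "closed (convex hull (A - {o0}))"
    using fin by (intro compact_imp_closed compact_convex_hull finite_imp_compact) auto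
  then obtain m k where mk: "inner m o0 < k" "\<forall>x\<in>convex hull (A - {o0}). k < inner m x"
    using separating_hyperplane_closed_point[of "convex hull (A - {o0})" o0] A o
    unfolding convex_position_def by (auto simp: convex_convex_hull)
  \<comment> \<open>The separating line confines the vectors \<open>a - o0\<close> to an open
    half-plane; there the relation of pointing to the left is transitive.\<close>
  have m: "inner m (a - o0) > 0" if "a \<in> A" "a \<noteq> o0" for a
    using mk hull_inc[of a "A - {o0}" convex] that by (force simp: inner_diff_right)
  define lt where "lt a b \<longleftrightarrow> a \<in> A \<and> b \<in> A \<and> b \<noteq> o0 \<and> (a = o0 \<or> cr (a - o0) (b - o0) > 0)" for a b
  have irr: "\<not> lt a a" for a by (auto simp: lt_def cr_def)
  have cr_pos: "cr u w > 0" if "cr u v > 0" "cr v w > 0" "inner m u > 0" "inner m v > 0" "inner m w > 0" for u v w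
  proof -
    have "cr u v *\<^sub>R w + cr v w *\<^sub>R u = cr u w *\<^sub>R v"
      by (simp add: vec2_eq_iff cr_def algebra_simps)
    then have "cr u w * inner m v = cr u v * inner m w + cr v w * inner m u"
      by (metis inner_add_right inner_scaleR_right)
    then have "cr u w * inner m v > 0" using that by (simp add: add_pos_pos)
    then show ?thesis using that by (simp add: zero_less_mult_iff)
  qed
  have trans: "lt a c" if "lt a b" "lt b c" for a b c
    using that cr_pos[of "a - o0" "b - o0" "c - o0"] m unfolding lt_def by blast
  have tot: "lt a b \<or> lt b a" if "a \<in> A" "b \<in> A" "a \<noteq> b" for a b
  proof -
    have "cr (a - o0) (b - o0) \<noteq> 0" if "a \<noteq> o0" "b \<noteq> o0"
      using nc[OF o \<open>a \<in> A\<close> \<open>b \<in> A\<close>] that \<open>a \<noteq> b\<close> by auto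
    moreover have "cr (b - o0) (a - o0) = - cr (a - o0) (b - o0)" by (simp add: cr_def)
    ultimately show ?thesis using that unfolding lt_def by fastforce
  qed
  have tri: "cr (b - a) (c - a) > 0" if l: "lt a b" "lt b c" for a b c
  proof (cases "a = o0")
    case True
    then show ?thesis using l by (auto simp: lt_def)
  next
    case False
    define u v w where "u = a - o0" and "v = b - o0" and "w = c - o0"
    have i: "a \<in> A" "b \<in> A" "c \<in> A" "b \<noteq> o0" "c \<noteq> o0" and d: "a \<noteq> b" "b \<noteq> c" "a \<noteq> c"
      using l irr trans by (auto simp: lt_def)
    have p: "cr u v > 0" "cr v w > 0" "cr u w > 0"
      using l trans[OF l] False by (auto simp: lt_def u_def v_def w_def)
    have s: "cr (b - a) (c - a) = cr u v + cr v w - cr u w"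
      by (simp add: cr_def u_def v_def w_def algebra_simps)
    show ?thesis
    proof (rule ccontr)
      assume "\<not> ?thesis"
      then have le: "cr u v + cr v w \<le> cr u w" using s by simp
      \<comment> \<open>Were the triple not positively oriented, \<open>b\<close> would lie in the
        triangle \<open>o0\<close>, \<open>a\<close>, \<open>c\<close>; \<open>x\<close> and
        \<open>y\<close> are its coordinates at \<open>a\<close> and \<open>c\<close>.\<close>
      define x y where "x = cr v w / cr u w" and "y = cr u v / cr u w"
      have "cr u v *\<^sub>R w + cr v w *\<^sub>R u = cr u w *\<^sub>R v"
        by (simp add: vec2_eq_iff cr_def algebra_simps)
      then have "(1 / cr u w) *\<^sub>R (cr u v *\<^sub>R w + cr v w *\<^sub>R u) = v" using p by simp
      then have "v = y *\<^sub>R w + x *\<^sub>R u" by (simp add: x_def y_def scaleR_right_distrib)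
      then have "b = (1 - x - y) *\<^sub>R o0 + x *\<^sub>R a + y *\<^sub>R c"
        by (simp add: u_def v_def w_def algebra_simps)
      moreover have "x \<ge> 0" "y \<ge> 0" using p by (simp_all add: x_def y_def)
      moreover have "x + y \<le> 1" using le p by (simp add: x_def y_def flip: add_divide_distrib)
      ultimately show False
        using convex_position_no_combination[OF A i(2) o i(1,3), of "1 - x - y" x y] d i by auto
    qed
  qed
  define idx where "idx a = card {c. lt c a}" for a
  have sub: "{c. lt c a} \<subseteq> A" for a by (auto simp: lt_def)
  have mono: "idx a < idx b" if "lt a b" for a b
    unfolding idx_def
  proof (rule psubset_card_mono)
    show "finite {c. lt c b}" using sub fin finite_subset by blast
    show "{c. lt c a} \<subset> {c. lt c b}" using that irr trans by blast
  qed
  have lt: "lt a b" if "a \<in> A" "b \<in> A" "idx a < idx b" for a b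
    using tot[OF that(1,2)] mono[of b a] that by fastforce
  show ?thesis
  proof
    show "inj_on idx A"
      using tot mono by (metis inj_onI less_irrefl)
    show "idx ` A \<subseteq> {..<card A}"
      unfolding idx_def using sub fin irr by (auto intro!: psubset_card_mono)
    show "cr (b - a) (c - a) > 0" if "a \<in> A" "b \<in> A" "c \<in> A" "idx a < idx b" "idx b < idx c" for a b c
      using tri lt that by blast
  qed
qed

subsection \<open>Common triples of increasing chains\<close>

definition block :: "nat \<Rightarrow> nat \<times> nat \<Rightarrow> nat \<times> nat" where
  "block B x = (fst x div B, snd x div B)"

definition increasing_chain :: "(nat \<times> nat) set \<Rightarrow> bool" where
  "increasing_chain G \<longleftrightarrow> (\<forall>x\<in>G. \<forall>y\<in>G. x \<noteq> y \<longrightarrow>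
    fst x < fst y \<and> snd x < snd y \<or> fst y < fst x \<and> snd y < snd x)"

text \<open>Blocks of comparable points are weakly comparable, so the coordinate sum separates the
  blocks that the chain meets; it ranges from 0 to \<open>2 * (n div B)\<close>.\<close>

lemma card_blocks_increasing_chain:
  assumes "increasing_chain G" "G \<subseteq> {..<n} \<times> {..<n}"
  shows "card (block B ` G) \<le> 2 * (n div B) + 1"
proof -
  have "inj_on (\<lambda>b. fst b + snd b) (block B ` G)"
  proof (rule inj_onI)
    fix c d assume "c \<in> block B ` G" "d \<in> block B ` G" and e: "fst c + snd c = fst d + snd d"
    then obtain x y where xy: "x \<in> G" "y \<in> G" "c = block B x" "d = block B y" by blast
    then consider "fst x \<le> fst y" "snd x \<le> snd y" | "fst y \<le> fst x" "snd y \<le> snd x"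
      using assms(1) unfolding increasing_chain_def by (metis less_imp_le order_refl)
    then have "fst c \<le> fst d \<and> snd c \<le> snd d \<or> fst d \<le> fst c \<and> snd d \<le> snd c"
      unfolding xy block_def by cases (simp_all add: div_le_mono)
    then show "c = d" using e by (auto simp: prod_eq_iff)
  qed
  moreover have "(\<lambda>b. fst b + snd b) ` block B ` G \<subseteq> {..2 * (n div B)}"
  proof (clarsimp simp: block_def)
    fix a b assume "(a, b) \<in> G"
    then have "a \<le> n" "b \<le> n" using assms(2) by auto
    then show "a div B + b div B \<le> 2 * (n div B)"
      using div_le_mono[of a n B] div_le_mono[of b n B] by linarith
  qed
  ultimately show ?thesis
    using card_inj_on_le[of "\<lambda>b. fst b + snd b" "block B ` G" "{..2 * (n div B)}"] by simp
qed

text \<open>These candidates do not refer to any chain: for constant \<open>B\<close> there are only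
  O(n^2) of them, shared by all chains.\<close>

definition block_triples :: "nat \<Rightarrow> nat \<Rightarrow> (nat \<times> nat) set set" where
  "block_triples n B = {S. S \<subseteq> {..<n} \<times> {..<n} \<and> card S = 3 \<and> (\<exists>b. block B ` S \<subseteq> {b})}"

lemma finite_block_triples: "finite (block_triples n B)"
  by (rule finite_subset[of _ "Pow ({..<n} \<times> {..<n})"]) (auto simp: block_triples_def)

text \<open>A triple is one of the at most \<open>2 ^ (B * B)\<close> subsets of its cell; such a
  crude factor is harmless because \<open>B\<close> will be constant.\<close>

lemma card_block_triples:
  assumes "B > 0"
  shows "card (block_triples n B) \<le> (n div B + 1)\<^sup>2 * 2 ^ (B * B)"
proof -
  define cell where "cell = (\<lambda>b::nat \<times> nat. {fst b * B..<fst b * B + B} \<times> {snd b * B..<snd b * B + B})"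
  let ?I = "{..n div B} \<times> {..n div B}"
  have "block_triples n B \<subseteq> (\<Union>b\<in>?I. Pow (cell b))"
  proof
    fix S assume S: "S \<in> block_triples n B"
    then obtain b where b: "S \<subseteq> {..<n} \<times> {..<n}" "S \<noteq> {}" "block B ` S \<subseteq> {b}"
      unfolding block_triples_def by fastforce
    have "S \<subseteq> cell b"
    proof
      fix x assume "x \<in> S"
      then have "block B x = b" using b by auto
      then have "fst b = fst x div B" "snd b = snd x div B" by (auto simp: block_def)
      then show "x \<in> cell b"
        using assms by (cases x) (auto simp: cell_def div_times_less_eq_dividend dividend_less_div_times add.commute)
    qed
    moreover have "b \<in> ?I"
    proof -
      obtain x where "x \<in> S" using b by blast
      then have "block B x = b" "fst x \<le> n" "snd x \<le> n" using b by auto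
      then show ?thesis by (auto simp: block_def intro: div_le_mono)
    qed
    ultimately show "S \<in> (\<Union>b\<in>?I. Pow (cell b))" by blast
  qed
  then have "card (block_triples n B) \<le> card (\<Union>b\<in>?I. Pow (cell b))"
    by (intro card_mono) (auto simp: cell_def)
  also have "\<dots> \<le> (\<Sum>b\<in>?I. card (Pow (cell b)))"
    by (intro card_UN_le) auto
  also have "\<dots> = (n div B + 1)\<^sup>2 * 2 ^ (B * B)"
    by (simp add: card_Pow cell_def power2_eq_square)
  finally show ?thesis .
qed

text \<open>Used for the \<open>m\<close> points of a chain in one block: counting triples instead
  of points loses at most two per block.\<close>

lemma le_choose_three_plus_two: "m \<le> (m choose 3) + 2"
proof (induction m)
  case (Suc m)
  show ?case
  proof (cases "m < 2")
    case False
    then have "m choose 2 > 0" by simp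
    moreover have "Suc m choose 3 = (m choose 2) + (m choose 3)"
      using binomial_Suc_Suc[of m 2] by (simp add: eval_nat_numeral)
    ultimately show ?thesis using Suc by linarith
  qed auto
qed simp

text \<open>Triples from different blocks are distinct, and each of the few blocks that
  \<open>G\<close> meets loses at most two points.\<close>

lemma card_block_triples_in_chain:
  assumes G: "increasing_chain G" "G \<subseteq> {..<n} \<times> {..<n}"
  shows "card G \<le> card {S \<in> block_triples n B. S \<subseteq> G} + 2 * (2 * (n div B) + 1)"
proof -
  have fin: "finite G" using G(2) finite_subset by blast
  define F where "F b = {x \<in> G. block B x = b}" for b
  define T where "T b = {S. S \<subseteq> F b \<and> card S = 3}" for b
  have finF: "finite (F b)" for b using fin by (simp add: F_def)
  then have finT: "finite (T b)" for b
    unfolding T_def by (rule_tac finite_subset[of _ "Pow (F b)"]) auto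
  have "(\<Sum>b\<in>block B ` G. card (T b)) = card (\<Union>b\<in>block B ` G. T b)"
  proof (rule card_UN_disjoint[symmetric])
    show "\<forall>b\<in>block B ` G. \<forall>b'\<in>block B ` G. b \<noteq> b' \<longrightarrow> T b \<inter> T b' = {}"
    proof (intro ballI impI)
      fix b b' :: "nat \<times> nat" assume "b \<noteq> b'"
      then have "F b \<inter> F b' = {}" by (auto simp: F_def)
      then have "card S = 0" if "S \<subseteq> F b" "S \<subseteq> F b'" for S
        using that by (metis Int_greatest card.empty subset_empty)
      then show "T b \<inter> T b' = {}" unfolding T_def by (auto simp: disjoint_iff)
    qed
  qed (use fin finT in auto)
  also have "\<dots> \<le> card {S \<in> block_triples n B. S \<subseteq> G}"
  proof (rule card_mono)
    show "finite {S \<in> block_triples n B. S \<subseteq> G}" using finite_block_triples by simp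
    show "(\<Union>b\<in>block B ` G. T b) \<subseteq> {S \<in> block_triples n B. S \<subseteq> G}"
    proof
      fix S assume "S \<in> (\<Union>b\<in>block B ` G. T b)"
      then obtain b where "S \<subseteq> F b" "card S = 3" unfolding T_def by blast
      moreover from this have "S \<subseteq> G" "block B ` S \<subseteq> {b}" by (auto simp: F_def)
      ultimately show "S \<in> {S \<in> block_triples n B. S \<subseteq> G}"
        using G(2) unfolding block_triples_def by blast
    qed
  qed
  finally have T_sum: "(\<Sum>b\<in>block B ` G. card (T b)) \<le> card {S \<in> block_triples n B. S \<subseteq> G}" .
  have "card G = (\<Sum>b\<in>block B ` G. card (F b))"
    using sum.image_gen[OF fin, of "\<lambda>_. 1::nat" "block B"] by (simp add: F_def)
  also have "\<dots> \<le> (\<Sum>b\<in>block B ` G. card (T b) + 2)"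
    unfolding T_def n_subsets[OF finF] by (intro sum_mono le_choose_three_plus_two)
  also have "\<dots> = (\<Sum>b\<in>block B ` G. card (T b)) + 2 * card (block B ` G)"
    unfolding sum.distrib by simp
  also have "\<dots> \<le> card {S \<in> block_triples n B. S \<subseteq> G} + 2 * (2 * (n div B) + 1)"
    using T_sum card_blocks_increasing_chain[OF G, of B] by (intro add_mono mult_le_mono2)
  finally show ?thesis .
qed

text \<open>Double counting of pairs of a chain and a block triple inside it: there are at least a
  constant times n^3 such pairs, but only O(n^2) block triples.\<close>

lemma common_triple_of_chains:
  fixes \<kappa> :: real
  assumes "\<kappa> > 0"
  obtains \<epsilon> :: real and n1 :: nat where "\<epsilon> > 0"
    "\<And>n (V :: 'v set) G. n \<ge> n1 \<Longrightarrow> finite V \<Longrightarrow> card V \<le> n\<^sup>2 \<Longrightarrow>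
      (\<And>v. v \<in> V \<Longrightarrow> increasing_chain (G v) \<and> G v \<subseteq> {..<n} \<times> {..<n}) \<Longrightarrow>
      real (\<Sum>v\<in>V. card (G v)) \<ge> \<kappa> * real n ^ 3 \<Longrightarrow>
      \<exists>S. card S = 3 \<and> real (card {v \<in> V. S \<subseteq> G v}) \<ge> \<epsilon> * real n"
proof -
  \<comment> \<open>For \<open>n \<ge> B\<close> a chain loses at most \<open>6 * n / B\<close>
    points, which this \<open>B\<close> makes at most \<open>\<kappa> * n / 2\<close>. The choice of
    \<open>\<epsilon>\<close> keeps the contribution of the at most
    \<open>4 * n^2 * 2 ^ (B * B)\<close> triples below \<open>\<kappa> * n^3 / 4\<close>. Together
    this falls short of \<open>\<kappa> * n^3\<close>.\<close>
  define B where "B = nat \<lceil>12 / \<kappa>\<rceil> + 1"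
  define \<epsilon> where "\<epsilon> = \<kappa> / (16 * 2 ^ (B * B))"
  have B: "B > 0" "real B \<ge> 12 / \<kappa>" unfolding B_def by linarith+
  have "\<epsilon> > 0" using assms by (simp add: \<epsilon>_def)
  have "\<exists>S. card S = 3 \<and> real (card {v \<in> V. S \<subseteq> G v}) \<ge> \<epsilon> * real n"
    if n: "n \<ge> B" and V: "finite V" "card V \<le> n\<^sup>2"
      and G: "\<And>v. v \<in> V \<Longrightarrow> increasing_chain (G v) \<and> G v \<subseteq> {..<n} \<times> {..<n}"
      and big: "real (\<Sum>v\<in>V. card (G v)) \<ge> \<kappa> * real n ^ 3"
    for n and V :: "'v set" and G
  proof (rule ccontr)
    assume no: "\<not> ?thesis"
    let ?T = "block_triples n B"
    have n0: "real n > 0" using n B by simp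
    have R: "real (n div B) \<le> real n / real B" 
    proof -
      have "real (n div B * B) \<le> real n" by (intro of_nat_mono div_times_less_eq_dividend)
      then show ?thesis using B by (simp add: field_simps)
    qed
    have nB: "1 \<le> real n / real B" using n B by simp
    have small: "real (card {v \<in> V. S \<subseteq> G v}) \<le> \<epsilon> * real n" if "S \<in> ?T" for S
      using no that unfolding block_triples_def by fastforce
    have "\<kappa> * real n ^ 3 \<le> real (\<Sum>v\<in>V. card {S \<in> ?T. S \<subseteq> G v} + 2 * (2 * (n div B) + 1))"
    proof -
      have "(\<Sum>v\<in>V. card (G v)) \<le> (\<Sum>v\<in>V. card {S \<in> ?T. S \<subseteq> G v} + 2 * (2 * (n div B) + 1))"
        using G by (intro sum_mono card_block_triples_in_chain) auto
      then show ?thesis using big by linarith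
    qed
    also have "\<dots> = real (\<Sum>v\<in>V. card {S \<in> ?T. S \<subseteq> G v}) + real (card V) * (2 * (2 * real (n div B) + 1))"
      unfolding sum.distrib by (simp add: algebra_simps)
    also have "\<dots> \<le> real (\<Sum>v\<in>V. card {S \<in> ?T. S \<subseteq> G v}) + real n ^ 2 * (\<kappa> / 2 * real n)"
    proof -
      have "2 * (2 * real (n div B) + 1) \<le> 6 * (real n / real B)"
      proof -
        have "4 * real (n div B) + 2 \<le> 6 * (real n / real B)" using R nB by linarith
        then show ?thesis by (simp add: algebra_simps)
      qed
      also have "\<dots> \<le> \<kappa> / 2 * real n"
      proof -
        have "12 \<le> \<kappa> * real B" using B assms by (simp add: field_simps)
        then have "12 * real n \<le> \<kappa> * real B * real n" using n0 by (intro mult_right_mono) auto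
        then show ?thesis using B by (simp add: field_simps)
      qed
      finally have a: "2 * (2 * real (n div B) + 1) \<le> \<kappa> / 2 * real n" .
      have b: "real (card V) \<le> real n ^ 2" using V(2) by (metis of_nat_le_iff of_nat_power)
      show ?thesis by (intro add_left_mono mult_mono[OF b a]) auto
    qed
    also have "(\<Sum>v\<in>V. card {S \<in> ?T. S \<subseteq> G v}) = (\<Sum>S\<in>?T. card {v \<in> V. S \<subseteq> G v})"
      using V by (intro sum_multicount_gen[symmetric] finite_block_triples) auto
    also have "real (\<Sum>S\<in>?T. card {v \<in> V. S \<subseteq> G v}) \<le> real (card ?T) * (\<epsilon> * real n)"
      unfolding of_nat_sum using sum_bounded_above[of ?T, OF small] by simp
    also have "\<dots> \<le> (4 * real n ^ 2 * 2 ^ (B * B)) * (\<epsilon> * real n)"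
    proof -
      have "n div B + 1 \<le> 2 * n" using n B div_le_dividend[of n B] by linarith
      then have "(n div B + 1)\<^sup>2 \<le> (2 * n)\<^sup>2" by (rule power_mono) simp
      then have "card ?T \<le> (2 * n)\<^sup>2 * 2 ^ (B * B)"
        using card_block_triples[OF B(1), of n] by (meson le_trans mult_le_mono1)
      then have "real (card ?T) \<le> real ((2 * n)\<^sup>2 * 2 ^ (B * B))" by (rule of_nat_mono)
      then show ?thesis using \<open>\<epsilon> > 0\<close> by (intro mult_right_mono) (auto simp: power_mult_distrib)
    qed
    also have "\<dots> = \<kappa> / 4 * real n ^ 3"
      by (simp add: \<epsilon>_def power2_eq_square power3_eq_cube)
    finally have "\<kappa> * real n ^ 3 \<le> \<kappa> / 4 * real n ^ 3 + \<kappa> / 2 * real n ^ 3"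
      by (simp add: power2_eq_square power3_eq_cube algebra_simps)
    moreover have "\<kappa> * real n ^ 3 > 0" using assms n0 by simp
    ultimately show False by (simp add: field_simps)
  qed
  then show ?thesis using that \<open>\<epsilon> > 0\<close> by blast
qed

text \<open>Cauchy--Schwarz for the fibre sizes of \<open>k\<close>: they sum to
  \<open>card E\<close>, and their squares sum to the number of pairs with equal value.\<close>

lemma card_squared_le_card_kernel:
  assumes "finite E"
  shows "(card E)\<^sup>2 \<le> card (k ` E) * card {(e, e') \<in> E \<times> E. k e = k e'}"
proof -
  define F where "F x = {e \<in> E. k e = x}" for x
  have finF: "finite (F x)" for x using assms by (simp add: F_def)
  have "card E = (\<Sum>x\<in>k ` E. card (F x))"
    using sum.image_gen[OF assms, of "\<lambda>_. 1::nat" k] by (simp add: F_def)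
  moreover have "{(e, e') \<in> E \<times> E. k e = k e'} = (\<Union>x\<in>k ` E. F x \<times> F x)"
    by (auto simp: F_def)
  moreover have "card (\<Union>x\<in>k ` E. F x \<times> F x) = (\<Sum>x\<in>k ` E. (card (F x))\<^sup>2)"
    using assms finF
    by (subst card_UN_disjoint) (auto simp: F_def card_cartesian_product power2_eq_square)
  moreover have "(real (\<Sum>x\<in>k ` E. card (F x)))\<^sup>2 \<le> real (\<Sum>x\<in>k ` E. (card (F x))\<^sup>2) * real (card (k ` E))"
    using sum_squared_le_sum_of_squares[of "\<lambda>x. real (card (F x))" "k ` E"] by simp
  ultimately show ?thesis
    by (metis (no_types, lifting) mult.commute of_nat_le_iff of_nat_mult of_nat_power)
qed

subsection \<open>Chords with few directions\<close>

lemma finite_determined_directions: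
  assumes "finite A" "P \<subseteq> point_pairs A"
  shows "finite (determined_directions P)"
proof (rule finite_subset)
  show "determined_directions P \<subseteq> (\<lambda>(p, q). direction p q) ` (A \<times> A)"
    using assms(2) by (force simp: determined_directions_def point_pairs_def doubleton_eq_iff)
qed (use assms in simp)

text \<open>A line through the origin contains only two unit vectors, so orienting the chords at
  most doubles the number of directions.\<close>

lemma card_sgn_le_determined_directions:
  assumes A: "finite A" "P \<subseteq> point_pairs A"
    and E: "\<And>p q. (p, q) \<in> E \<Longrightarrow> {p, q} \<in> P \<and> p \<noteq> q"
  shows "card ((\<lambda>(p, q). sgn (q - p)) ` E) \<le> 2 * card (determined_directions P)"
proof -
  let ?U = "\<lambda>d::(real^2) set. {u \<in> d. norm u = 1}"
  have U: "finite (?U d) \<and> card (?U d) \<le> 2" if d: "d \<in> determined_directions P" for d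
  proof -
    obtain p q where pq: "d = span {q - p}" "p \<noteq> q"
      using d by (auto simp: determined_directions_def direction_def)
    have sub: "?U d \<subseteq> {sgn (q - p), - sgn (q - p)}"
    proof
      fix u assume u: "u \<in> ?U d"
      then obtain k where k: "u = k *\<^sub>R (q - p)" "norm u = 1"
        using pq by (auto simp: span_singleton)
      then have "sgn u = sgn k *\<^sub>R sgn (q - p)" "k \<noteq> 0" by (auto simp: sgn_scaleR)
      moreover have "sgn u = u" using k by (simp add: sgn_div_norm)
      ultimately show "u \<in> {sgn (q - p), - sgn (q - p)}" by (cases "k > 0") auto
    qed
    then show ?thesis
      using card_mono[OF _ sub] finite_subset[OF sub] card_insert_le_m1[of 2 "{- sgn (q - p)}" "sgn (q - p)"]
      by simp
  qed
  have fin: "finite (determined_directions P)" using finite_determined_directions[OF A] .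
  have "(\<lambda>(p, q). sgn (q - p)) ` E \<subseteq> (\<Union>d\<in>determined_directions P. ?U d)"
  proof clarify
    fix p q assume pq: "(p, q) \<in> E"
    then have "direction p q \<in> determined_directions P"
      using E[OF pq] unfolding determined_directions_def by blast
    moreover have "sgn (q - p) \<in> direction p q"
      unfolding direction_def sgn_div_norm by (intro span_scale span_base) simp
    moreover have "norm (sgn (q - p)) = 1" using E[OF pq] by (auto simp: norm_sgn)
    ultimately show "sgn (q - p) \<in> (\<Union>d\<in>determined_directions P. ?U d)" by blast
  qed
  then have "card ((\<lambda>(p, q). sgn (q - p)) ` E) \<le> card (\<Union>d\<in>determined_directions P. ?U d)"
    using fin U by (intro card_mono) auto
  also have "\<dots> \<le> (\<Sum>d\<in>determined_directions P. card (?U d))"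
    by (rule card_UN_le[OF fin])
  also have "\<dots> \<le> (\<Sum>d\<in>determined_directions P. 2)"
    using U by (intro sum_mono) auto
  finally show ?thesis by (simp add: mult.commute)
qed

text \<open>As \<open>a\<close> advances among the points before \<open>b\<close>, the vector
  \<open>b - a\<close> turns counterclockwise, so the sign of \<open>cr (b - a) (b - c)\<close>
  reveals the order of \<open>a\<close> and \<open>c\<close>. Passing to \<open>b' - a'\<close> and
  \<open>b' - c'\<close> multiplies it by positive factors, so \<open>a'\<close> and
  \<open>c'\<close> are in the same order.\<close>

lemma increasing_chain_of_parallel_chords:
  fixes idx :: "real^2 \<Rightarrow> nat"
  assumes inj: "inj_on idx A"
    and pos: "\<And>a b c. a \<in> A \<Longrightarrow> b \<in> A \<Longrightarrow> c \<in> A \<Longrightarrow> idx a < idx b \<Longrightarrow> idx b < idx c \<Longrightarrow> cr (b - a) (c - a) > 0"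
    and R: "\<And>a a'. (a, a') \<in> R \<Longrightarrow> a \<in> A \<and> a' \<in> A \<and> idx a < idx b \<and> idx a' < idx b'
      \<and> sgn (b - a) = sgn (b' - a')"
    and b: "b \<in> A" "b' \<in> A"
  shows "increasing_chain ((\<lambda>(a, a'). (idx a, idx a')) ` R)"
proof -
  have turn: "cr (y - x) (y - z) > 0" if "x \<in> A" "y \<in> A" "z \<in> A" "idx x < idx z" "idx z < idx y" for x y z
    using pos[OF that(1,3,2,4,5)] by (simp add: cr_def algebra_simps)
  have scaled: "sgn (cr (b' - a') (b' - c')) = sgn (cr (b - a) (b - c))"
    if r: "(a, a') \<in> R" "(c, c') \<in> R" for a a' c c'
  proof -
    have "b - a \<noteq> 0" "b - c \<noteq> 0" using R[OF r(1)] R[OF r(2)] by auto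
    obtain l where "l > 0" "b' - a' = l *\<^sub>R (b - a)"
      using sgn_eq_imp_scaled[of "b - a" "b' - a'"] R[OF r(1)] \<open>b - a \<noteq> 0\<close> by blast
    moreover obtain m where "m > 0" "b' - c' = m *\<^sub>R (b - c)"
      using sgn_eq_imp_scaled[of "b - c" "b' - c'"] R[OF r(2)] \<open>b - c \<noteq> 0\<close> by blast
    moreover have "cr (l *\<^sub>R (b - a)) (m *\<^sub>R (b - c)) = l * m * cr (b - a) (b - c)"
      by (simp add: cr_def algebra_simps)
    ultimately show ?thesis by (simp add: sgn_mult)
  qed
  have sg: "sgn (cr (y - x) (y - z)) = sgn (real (idx z) - real (idx x))"
    if i: "x \<in> A" "y \<in> A" "z \<in> A" "idx x < idx y" "idx z < idx y" for x y z
  proof -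
    have anti: "cr (y - x) (y - z) = - cr (y - z) (y - x)" by (simp add: cr_def)
    consider "idx x < idx z" | "x = z" | "idx z < idx x"
      using inj_onD[OF inj _ i(1,3)] linorder_neqE_nat[of "idx x" "idx z"] by blast
    then show ?thesis
    proof cases
      case 1 then show ?thesis using turn[of x y z] that by simp
    next
      case 2 then show ?thesis by (simp add: cr_def)
    next
      case 3 then show ?thesis using turn[of z y x] that anti by simp
    qed
  qed
  have sgn_cases: "s < r \<and> q < p \<or> r < s \<and> p < q \<or> (s = r \<and> q = p)"
    if "sgn (real p - real q) = sgn (real r - real s)" for p q r s :: nat
    using that by (auto simp: sgn_if split: if_splits)
  have "sgn (real (idx c') - real (idx a')) = sgn (real (idx c) - real (idx a))"
    if "(a, a') \<in> R" "(c, c') \<in> R" for a a' c c'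
    using scaled[OF that] sg[of a b c] sg[of a' b' c'] R[OF that(1)] R[OF that(2)] b by simp
  then have "idx a < idx c \<and> idx a' < idx c' \<or> idx c < idx a \<and> idx c' < idx a' \<or> (idx a = idx c \<and> idx a' = idx c')"
    if "(a, a') \<in> R" "(c, c') \<in> R" for a a' c c'
    using sgn_cases that by blast
  then show ?thesis unfolding increasing_chain_def by fastforce
qed

theorem theorem4p2:
  fixes D c :: real
  assumes "D > 0" and "c > 0"
  shows "\<exists>\<delta>>0. \<exists>n\<^sub>0::nat. \<forall>A :: (real^2) set.
    finite A \<and> convex_position A \<and> card A \<ge> n\<^sub>0 \<and>
    (\<exists>P \<subseteq> point_pairs A.
       real (card P) \<ge> c * (real (card A))\<^sup>2 \<and>
       real (card (determined_directions P)) \<le> D * real (card A))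
    \<longrightarrow> (\<exists>C. is_conic C \<and> real (card (A \<inter> C)) \<ge> \<delta> * real (card A))"
proof -
  \<comment> \<open>Cauchy--Schwarz yields at least
    \<open>(c * n^2)^2 / (2 * D * n) = 2 * \<kappa> * n^3\<close> parallel pairs; half of them is
    reserved for the pairs of a chord with itself.\<close>
  define \<kappa> where "\<kappa> = c\<^sup>2 / (4 * D)"
  have "\<kappa> > 0" using assms by (simp add: \<kappa>_def)
  then obtain \<epsilon> :: real and n1 :: nat where \<epsilon>: "\<epsilon> > 0"
    and common: "\<And>n (V :: ((real^2) \<times> (real^2)) set) G. n \<ge> n1 \<Longrightarrow> finite V \<Longrightarrow> card V \<le> n\<^sup>2 \<Longrightarrow>
      (\<And>v. v \<in> V \<Longrightarrow> increasing_chain (G v) \<and> G v \<subseteq> {..<n} \<times> {..<n}) \<Longrightarrow>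
      real (\<Sum>v\<in>V. card (G v)) \<ge> \<kappa> * real n ^ 3 \<Longrightarrow>
      \<exists>S. card S = 3 \<and> real (card {v \<in> V. S \<subseteq> G v}) \<ge> \<epsilon> * real n"
    by (rule common_triple_of_chains) blast
  \<comment> \<open>From \<open>1 / \<kappa>\<close> on, the at most \<open>n^2\<close> trivial
    pairs are covered by \<open>\<kappa> * n^3\<close>; \<open>5 / \<epsilon>\<close> provides the
    five points that certify a conic.\<close>
  define n0 where "n0 = max (max n1 1) (max (nat \<lceil>1 / \<kappa>\<rceil>) (nat \<lceil>5 / \<epsilon>\<rceil>))"
  have "\<exists>C. is_conic C \<and> real (card (A \<inter> C)) \<ge> \<epsilon> * real (card A)"
    if fin: "finite A" and conv: "convex_position A" and n: "card A \<ge> n0" and P: "P \<subseteq> point_pairs A"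
      and many: "real (card P) \<ge> c * (real (card A))\<^sup>2"
      and few: "real (card (determined_directions P)) \<le> D * real (card A)"
    for A :: "(real^2) set" and P
  proof -
    let ?n = "card A"
    have n1: "?n \<ge> n1" "?n \<ge> 1" and nk: "real ?n \<ge> 1 / \<kappa>" and ne: "real ?n \<ge> 5 / \<epsilon>"
      using n unfolding n0_def by linarith+
    obtain idx :: "real^2 \<Rightarrow> nat" where inj: "inj_on idx A" and range: "idx ` A \<subseteq> {..<?n}"
      and pos: "\<And>a b c. a \<in> A \<Longrightarrow> b \<in> A \<Longrightarrow> c \<in> A \<Longrightarrow> idx a < idx b \<Longrightarrow> idx b < idx c \<Longrightarrow> cr (b - a) (c - a) > 0"
      using convex_position_cyclic_index[OF fin conv] by metis
    \<comment> \<open>Chords are oriented by increasing index. \<open>F\<close> collects the pairs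
      of distinct, parallel and equally oriented chords, \<open>R v\<close> their pairs of starting
      points when the end points form \<open>v\<close>, and \<open>G v\<close> is \<open>R v\<close>
      in the index grid.\<close>
    define E where "E = {(a, b) \<in> A \<times> A. idx a < idx b \<and> {a, b} \<in> P}"
    define F where "F = {(e, e') \<in> E \<times> E. sgn (snd e - fst e) = sgn (snd e' - fst e') \<and> e \<noteq> e'}"
    define R where "R v = {(a, a'). ((a, fst v), (a', snd v)) \<in> F}" for v
    define G where "G v = (\<lambda>(a, a'). (idx a, idx a')) ` R v" for v
    have finE: "finite E" by (rule finite_subset[of _ "A \<times> A"]) (use fin in \<open>auto simp: E_def\<close>)
    have E_le: "card E \<le> ?n\<^sup>2"
      using card_mono[of "A \<times> A" E] fin by (auto simp: E_def card_cartesian_product power2_eq_square)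
    have R: "a \<in> A \<and> a' \<in> A \<and> idx a < idx (fst v) \<and> idx a' < idx (snd v)
        \<and> fst v \<in> A \<and> snd v \<in> A \<and> sgn (fst v - a) = sgn (snd v - a') \<and> (a, fst v) \<noteq> (a', snd v)"
      if "(a, a') \<in> R v" for a a' v
      using that by (auto simp: R_def F_def E_def)

    have F_card: "real (card F) \<ge> \<kappa> * real ?n ^ 3"
    proof -
      let ?k = "\<lambda>(a, b). sgn (b - a :: real^2)"
      let ?Q = "{(e, e') \<in> E \<times> E. ?k e = ?k e'}"
      have "P \<subseteq> (\<lambda>(a, b). {a, b}) ` E"
      proof
        fix p assume p: "p \<in> P"
        then obtain a b where ab: "p = {a, b}" "a \<in> A" "b \<in> A" "a \<noteq> b"
          using P by (auto simp: point_pairs_def)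
        then have "(a, b) \<in> E \<or> (b, a) \<in> E"
          using p inj_onD[OF inj, of a b] linorder_neqE_nat[of "idx a" "idx b"]
          by (auto simp: E_def insert_commute)
        then show "p \<in> (\<lambda>(a, b). {a, b}) ` E" using ab by (auto simp: insert_commute)
      qed
      then have "card P \<le> card E" by (rule surj_card_le[OF finE])
      then have "c * (real ?n)\<^sup>2 \<le> real (card E)" using many by linarith
      then have sq: "(c * (real ?n)\<^sup>2)\<^sup>2 \<le> (real (card E))\<^sup>2"
        using assms by (intro power_mono) auto
      have "card (?k ` E) \<le> 2 * card (determined_directions P)"
        by (rule card_sgn_le_determined_directions[OF fin P]) (auto simp: E_def)
      then have kE: "real (card (?k ` E)) \<le> 2 * D * real ?n" using few by linarith
      have "real ((card E)\<^sup>2) \<le> real (card (?k ` E) * card ?Q)"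
        by (intro of_nat_mono card_squared_le_card_kernel finE)
      then have "(real (card E))\<^sup>2 \<le> real (card (?k ` E)) * real (card ?Q)"
        by simp
      also have "\<dots> \<le> 2 * D * real ?n * real (card ?Q)"
        using kE by (intro mult_right_mono) auto
      finally have "c\<^sup>2 * real ?n ^ 4 \<le> 2 * D * real ?n * real (card ?Q)"
        using sq by (simp add: power_mult_distrib)
      then have "real ?n * (c\<^sup>2 * real ?n ^ 3) \<le> real ?n * (2 * D * real (card ?Q))"
        by (simp add: eval_nat_numeral algebra_simps)
      then have "c\<^sup>2 * real ?n ^ 3 \<le> 2 * D * real (card ?Q)" using n1 by simp
      then have Q: "2 * \<kappa> * real ?n ^ 3 \<le> real (card ?Q)"
        using assms by (simp add: \<kappa>_def field_simps)
      have "?Q \<subseteq> F \<union> (\<lambda>e. (e, e)) ` E" by (auto simp: F_def)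
      then have "card ?Q \<le> card (F \<union> (\<lambda>e. (e, e)) ` E)"
        using finE by (intro card_mono finite_UnI finite_imageI finite_subset[of F "E \<times> E"]) (auto simp: F_def)
      also have "\<dots> \<le> card F + card E"
        using card_Un_le[of F "(\<lambda>e. (e, e)) ` E"] card_image_le[OF finE, of "\<lambda>e. (e, e)"] by linarith
      finally have "real (card ?Q) \<le> real (card F) + (real ?n)\<^sup>2"
        using E_le by (metis (no_types, lifting) add_left_mono le_trans of_nat_add of_nat_le_iff of_nat_power)
      moreover have "(real ?n)\<^sup>2 \<le> \<kappa> * real ?n ^ 3"
      proof -
        have "1 \<le> \<kappa> * real ?n" using nk \<open>\<kappa> > 0\<close> by (simp add: field_simps)
        then have "1 * (real ?n)\<^sup>2 \<le> \<kappa> * real ?n * (real ?n)\<^sup>2" by (intro mult_right_mono) auto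
        then show ?thesis by (simp add: power2_eq_square power3_eq_cube mult_ac)
      qed
      ultimately show ?thesis using Q by linarith
    qed

    have finG: "finite (G v)" for v
    proof -
      have "R v \<subseteq> A \<times> A"
      proof (rule subrelI)
        show "(a, a') \<in> A \<times> A" if "(a, a') \<in> R v" for a a' using R[OF that] by blast
      qed
      then show ?thesis using fin finite_subset unfolding G_def by blast
    qed
    \<comment> \<open>A pair of chords is recovered from its end points and the indices of its
      starting points.\<close>
    have "card F \<le> card (SIGMA v:A \<times> A. G v)"
    proof (rule card_inj_on_le)
      let ?f = "\<lambda>((a, b), (a', b')). ((b, b'), (idx a, idx a'))"
      have FA: "F \<subseteq> (A \<times> A) \<times> (A \<times> A)" by (auto simp: F_def E_def)
      show "inj_on ?f F"
      proof (rule inj_onI)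
        fix x y assume "x \<in> F" "y \<in> F" "?f x = ?f y"
        then show "x = y" using FA inj_onD[OF inj] by (auto split: prod.splits)
      qed
      show "?f ` F \<subseteq> (SIGMA v:A \<times> A. G v)"
        using FA unfolding G_def R_def by (auto simp: image_iff)
    qed (use fin finG in auto)
    also have "card (SIGMA v:A \<times> A. G v) = (\<Sum>v\<in>A \<times> A. card (G v))"
      using fin finG by (intro card_SigmaI) auto
    finally have G_card: "real (\<Sum>v\<in>A \<times> A. card (G v)) \<ge> \<kappa> * real ?n ^ 3"
      using F_card by linarith
    have chain: "increasing_chain (G v) \<and> G v \<subseteq> {..<?n} \<times> {..<?n}" if "v \<in> A \<times> A" for v
    proof
      show "increasing_chain (G v)"
        unfolding G_def
      proof (rule increasing_chain_of_parallel_chords[OF inj pos])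
        show "a \<in> A \<and> a' \<in> A \<and> idx a < idx (fst v) \<and> idx a' < idx (snd v)
            \<and> sgn (fst v - a) = sgn (snd v - a')" if "(a, a') \<in> R v" for a a'
          using R[OF that] by blast
        show "fst v \<in> A" "snd v \<in> A" using that by (auto simp: mem_Times_iff)
      qed
      show "G v \<subseteq> {..<?n} \<times> {..<?n}"
      proof
        fix x assume "x \<in> G v"
        then obtain a a' where "x = (idx a, idx a')" "(a, a') \<in> R v" unfolding G_def by auto
        then show "x \<in> {..<?n} \<times> {..<?n}" using R[of a a' v] range by blast
      qed
    qed
    obtain S where S: "card S = 3" "real (card {v \<in> A \<times> A. S \<subseteq> G v}) \<ge> \<epsilon> * real ?n"
      using common[OF n1(1) _ _ chain G_card] fin
      by (auto simp: card_cartesian_product power2_eq_square)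
    define Y where "Y = {v \<in> A \<times> A. S \<subseteq> G v}"
    have "5 \<le> \<epsilon> * real ?n" using ne \<epsilon> by (simp add: field_simps)
    then have Y5: "card Y \<ge> 5" using S(2) unfolding Y_def by linarith
    then have "Y \<noteq> {}" by auto
    then obtain v0 where v0: "v0 \<in> Y" by blast
    obtain s1 s2 s3 where s: "S = {s1, s2, s3}" "s1 \<noteq> s2" "s1 \<noteq> s3" "s2 \<noteq> s3"
      using S(1) by (auto simp: card_3_iff)
    have sG: "s1 \<in> G v0" "s2 \<in> G v0" "s3 \<in> G v0" using v0 s by (auto simp: Y_def)
    obtain a1 b1 a2 b2 a3 b3 where ab: "(a1, b1) \<in> R v0" "(a2, b2) \<in> R v0" "(a3, b3) \<in> R v0"
      and sab: "s1 = (idx a1, idx b1)" "s2 = (idx a2, idx b2)" "s3 = (idx a3, idx b3)"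
      using sG unfolding G_def by auto
    have inA: "a1 \<in> A" "a2 \<in> A" "a3 \<in> A" "b1 \<in> A" "b2 \<in> A" "b3 \<in> A"
      using R[OF ab(1)] R[OF ab(2)] R[OF ab(3)] by blast+
    \<comment> \<open>Distinct elements of a chain differ already in the first coordinate, which
      makes \<open>a1\<close>, \<open>a2\<close>, \<open>a3\<close> distinct.\<close>
    have "increasing_chain (G v0)" using chain v0 by (simp add: Y_def)
    then have "fst s1 \<noteq> fst s2" "fst s1 \<noteq> fst s3" "fst s2 \<noteq> fst s3"
      using sG s unfolding increasing_chain_def by (metis less_irrefl)+
    then have dist: "a1 \<noteq> a2" "a1 \<noteq> a3" "a2 \<noteq> a3" by (auto simp: sab)
    \<comment> \<open>Injectivity of \<open>idx\<close> lifts the common grid triple to the same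
      starting points for every \<open>v\<close> in \<open>Y\<close>.\<close>
    have inR: "(a1, b1) \<in> R v \<and> (a2, b2) \<in> R v \<and> (a3, b3) \<in> R v" if "v \<in> Y" for v
    proof -
      have lift: "(a, b) \<in> R v" if "(idx a, idx b) \<in> G v" "a \<in> A" "b \<in> A" for a b
      proof -
        obtain x y where "(x, y) \<in> R v" "idx x = idx a" "idx y = idx b"
          using \<open>(idx a, idx b) \<in> G v\<close> unfolding G_def by auto
        then show ?thesis using R[of x y v] inj_onD[OF inj, of x a] inj_onD[OF inj, of y b] that by blast
      qed
      have "S \<subseteq> G v" using that by (simp add: Y_def)
      then show ?thesis using lift inA s(1) sab by blast
    qed
    have "\<exists>C. is_conic C \<and> fst ` Y \<subseteq> C \<and> inj_on fst Y"
    proof (rule parallel_chords_on_conic[OF conv inA(1-3) dist inA(4) _ Y5])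
      show "Y \<subseteq> A \<times> A" by (auto simp: Y_def)
      fix y z assume yz: "(y, z) \<in> Y"
      note r = inR[OF yz]
      have R1: "idx a1 < idx y" "idx a2 < idx y" "idx a3 < idx y" "idx b1 < idx z" "y \<in> A" "z \<in> A"
        and sg: "sgn (y - a1) = sgn (z - b1)" and neq: "(a1, y) \<noteq> (b1, z)"
        using r R[of a1 b1 "(y, z)"] R[of a2 b2 "(y, z)"] R[of a3 b3 "(y, z)"] by auto
      show "sgn (y - a1) = sgn (z - b1) \<and> sgn (y - a2) = sgn (z - b2) \<and> sgn (y - a3) = sgn (z - b3)"
        using r R[of a1 b1 "(y, z)"] R[of a2 b2 "(y, z)"] R[of a3 b3 "(y, z)"] by auto
      \<comment> \<open>Parallel chords with a common end point would put \<open>a1\<close>,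
        \<open>b1\<close>, \<open>y\<close> on a line; \<open>a1\<close> and \<open>b1\<close>
        differ because \<open>F\<close> only contains pairs of distinct chords.\<close>
      have "y \<noteq> z"
      proof
        assume "y = z"
        then have d: "y \<noteq> a1" "y \<noteq> b1" "a1 \<noteq> b1" using R1 neq by auto
        obtain l where "y - b1 = l *\<^sub>R (y - a1)"
          using sgn_eq_imp_scaled[OF sg] d \<open>y = z\<close> by auto
        then have "cr (y - a1) (y - b1) = 0" by (simp add: cr_def)
        moreover have "cr (a1 - y) (b1 - y) = cr (y - a1) (y - b1)" by (simp add: cr_def algebra_simps)
        ultimately show False
          using convex_position_no_three_collinear[OF conv R1(5) inA(1,4) d] by simp
      qed
      then show "y \<noteq> z \<and> y \<noteq> a1 \<and> y \<noteq> a2 \<and> y \<noteq> a3" using R1 by auto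
    qed
    then obtain C where C: "is_conic C" "fst ` Y \<subseteq> C" "inj_on fst Y" by blast
    \<comment> \<open>Injectivity of \<open>fst\<close> turns the number of pairs into a number of
      points, so \<open>\<epsilon>\<close> itself serves as \<open>\<delta>\<close>.\<close>
    have "card Y = card (fst ` Y)" using C(3) by (simp add: card_image)
    also have "\<dots> \<le> card (A \<inter> C)"
      using C(2) fin by (intro card_mono) (auto simp: Y_def)
    finally show ?thesis using S(2) C(1) unfolding Y_def[symmetric]
      by (intro exI[of _ C]) linarith
  qed
  then show ?thesis using \<epsilon> by blast
qed

end
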